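(* Let $G$ be both a groupoid and a topological space (no compatibility assumed) with Hausdorff unit space $G^0$, and let $Y$ be a unital $1$-cancellative semigroup. If $S\subseteq{}_Y\mathcal{B}^\circ(G)$ is a compact-bumpy semigroup and $D=\{d\in S:\mathrm{dom}(d)\subseteq G^0\}$, then for all $a,b\in S$, $$a\prec b\qquad\Leftrightarrow\qquad\mathrm{dom}(a)\Subset[Y^\times]b.$$
   Context: For a groupoid $G$: $\mathsf{s}(g)=g^{-1}g$, $\mathsf{r}(g)=gg^{-1}$; $G^0$ is the set of units; $gh$ is defined iff $\mathsf{s}(g)=\mathsf{r}(h)$; for $X,X'\subseteq G$, $XX'=\{xx':x\in X,x'\in X',\mathsf{s}(x)=\mathsf{r}(x')\}$ and $X^{-1}=\{x^{-1}:x\in X\}$. A bisection is $B\subseteq G$ with $BB^{-1}\cup B^{-1}B\subseteq G^0$. $\mathcal{O}(G)$ is the topology of $G$; $\mathcal{B}^\circ(G)$ and $\mathcal{B}_\mathsf{c}(G)$ are the sets of open and of compact bisections respectively. $\mathrm{int}$ denotes interior in $G$. A unital semigroup $Y$ is $1$-cancellative if for all $x,y\in Y$: $xy=x\Leftrightarrow y=1\Leftrightarrow yx=x$. $Y^\times$ denotes its invertible elements. For a family $\mathcal{X}$ of subsets of $G$, ${}_Y\mathcal{X}$ is the set of partial functions $a$ from $G$ to $Y$ with domain $\mathrm{dom}(a)\in\mathcal{X}$. For $W\subseteq Y$, $[W]a=\{g\in\mathrm{dom}(a):a(g)\in W\}$, and $[1]a=[\{1\}]a$. If $\mathrm{dom}(a)$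 or $\mathrm{dom}(b)$ is a bisection, $ab$ is the function with domain $\mathrm{dom}(a)\mathrm{dom}(b)$ given by $ab(gh)=a(g)b(h)$ for $g\in\mathrm{dom}(a)$, $h\in\mathrm{dom}(b)$, $\mathsf{s}(g)=\mathsf{r}(h)$; semigroups of functions carry this product. $S\subseteq{}_Y\mathcal{B}^\circ(G)$ is bumpy if: (1-Proper) $[1]a$ is compact for all $a\in S$; (Urysohn) the empty function is in $S$, and whenever $g\in O\in\mathcal{O}(G)$ there is $a\in S$ with $\mathrm{dom}(a)\subseteq O$ and $g\in\mathrm{int}([Y^\times]a)$; (Involutive) whenever $a\in S$ and $g\in\mathrm{int}([Y^\times]a)$, there is $b\in S$ with $g^{-1}\in\mathrm{int}(\{h\in G:a(h^{-1})=b(h)^{-1}\})$. A bumpy $S$ is compact-bumpy if moreover: (Compact-Urysohn) for any $C\in\mathcal{B}_\mathsf{c}(G)$ and $O\in\mathcal{B}^\circ(G)$ with $C\subseteq O$ there is $a\in S$ with $\mathrm{dom}(a)\subseteq O$ and $C\subseteq[Y^\times]a$; (Compact-Involutive) if $a\in S$ and $C\subseteq[Y^\times]a$ is compact, there is $b\in S$ with $a(g)^{-1}=b(g^{-1})$ for all $g\in C$. Domination on $S$ (relative to $D$): $a\prec_s b$ iff $asb=a=bsa$ and $as,sa\in D$; $a\prec b$ iff $a\prec_s b$ for some $s\in S$. For $V,W\subseteq G$, $V\Subset W$ means there is a compact $C\subseteq G$ with $V\subseteq C\subseteq W$. *)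

theory Defs
  imports "HOL-Algebra.Group" "HOL-Analysis.T1_Spaces"
begin

section \<open>Groupoids\<close>

text \<open>The operations are total functions, as usual for structures with a carrier; products
  are meaningful only for composable pairs, i.e. when the source of the left factor is the range
  of the right factor.\<close>

record 'g groupoid = "'g partial_object" +
  gmult :: "'g \<Rightarrow> 'g \<Rightarrow> 'g" (infixl "\<cdot>\<index>" 70)
  ginv :: "'g \<Rightarrow> 'g"

definition src :: "('g, 'm) groupoid_scheme \<Rightarrow> 'g \<Rightarrow> 'g" where
  "src G g = ginv G g \<cdot>\<^bsub>G\<^esub> g"

definition rng :: "('g, 'm) groupoid_scheme \<Rightarrow> 'g \<Rightarrow> 'g" where
  "rng G g = g \<cdot>\<^bsub>G\<^esub> ginv G g"

definition units :: "('g, 'm) groupoid_scheme \<Rightarrow> 'g set" where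
  "units G = src G ` carrier G"

text \<open>The algebraic axioms of a groupoid (a small category with all arrows invertible), with
  the set of composable pairs taken to be the pairs with matching source and range.
  That $(g, g^{-1})$ and $(g^{-1}, g)$ are composable follows from involutivity.\<close>

locale groupoid =
  fixes G (structure)
  assumes ginv_closed: "g \<in> carrier G \<Longrightarrow> ginv G g \<in> carrier G"
    and ginv_ginv: "g \<in> carrier G \<Longrightarrow> ginv G (ginv G g) = g"
    and gmult_closed:
      "\<lbrakk>g \<in> carrier G; h \<in> carrier G; src G g = rng G h\<rbrakk> \<Longrightarrow> g \<cdot> h \<in> carrier G"
    and composable_left:
      "\<lbrakk>g \<in> carrier G; h \<in> carrier G; k \<in> carrier G; src G g = rng G h; src G h = rng G k\<rbrakk>
        \<Longrightarrow> src G (g \<cdot> h) = rng G k"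
    and composable_right:
      "\<lbrakk>g \<in> carrier G; h \<in> carrier G; k \<in> carrier G; src G g = rng G h; src G h = rng G k\<rbrakk>
        \<Longrightarrow> src G g = rng G (h \<cdot> k)"
    and gmult_assoc:
      "\<lbrakk>g \<in> carrier G; h \<in> carrier G; k \<in> carrier G; src G g = rng G h; src G h = rng G k\<rbrakk>
        \<Longrightarrow> (g \<cdot> h) \<cdot> k = g \<cdot> (h \<cdot> k)"
    and ginv_cancel_left:
      "\<lbrakk>g \<in> carrier G; h \<in> carrier G; src G g = rng G h\<rbrakk> \<Longrightarrow> ginv G g \<cdot> (g \<cdot> h) = h"
    and ginv_cancel_right:
      "\<lbrakk>g \<in> carrier G; h \<in> carrier G; src G g = rng G h\<rbrakk> \<Longrightarrow> (g \<cdot> h) \<cdot> ginv G h = g"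

definition set_gmult :: "('g, 'm) groupoid_scheme \<Rightarrow> 'g set \<Rightarrow> 'g set \<Rightarrow> 'g set" where
  "set_gmult G X X' = {x \<cdot>\<^bsub>G\<^esub> x' |x x'. x \<in> X \<and> x' \<in> X' \<and> src G x = rng G x'}"

definition bisection :: "('g, 'm) groupoid_scheme \<Rightarrow> 'g set \<Rightarrow> bool" where
  "bisection G B \<longleftrightarrow> B \<subseteq> carrier G \<and>
     set_gmult G B (ginv G ` B) \<union> set_gmult G (ginv G ` B) B \<subseteq> units G"

definition open_bisections :: "('g, 'm) groupoid_scheme \<Rightarrow> 'g topology \<Rightarrow> 'g set set" where
  "open_bisections G T = {B. openin T B \<and> bisection G B}"

definition compact_bisections :: "('g, 'm) groupoid_scheme \<Rightarrow> 'g topology \<Rightarrow> 'g set set" where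
  "compact_bisections G T = {B. compactin T B \<and> bisection G B}"

definition compactly_inside :: "'g topology \<Rightarrow> 'g set \<Rightarrow> 'g set \<Rightarrow> bool" where
  "compactly_inside T V W \<longleftrightarrow> (\<exists>C. compactin T C \<and> V \<subseteq> C \<and> C \<subseteq> W)"

section \<open>Partial functions into a unital semigroup\<close>

definition one_cancellative :: "('y, 'n) monoid_scheme \<Rightarrow> bool" where
  "one_cancellative Y \<longleftrightarrow> (\<forall>x\<in>carrier Y. \<forall>y\<in>carrier Y.
     (x \<otimes>\<^bsub>Y\<^esub> y = x \<longleftrightarrow> y = \<one>\<^bsub>Y\<^esub>) \<and> (y = \<one>\<^bsub>Y\<^esub> \<longleftrightarrow> y \<otimes>\<^bsub>Y\<^esub> x = x))"

definition partial_funs :: "('y, 'n) monoid_scheme \<Rightarrow> 'g set set \<Rightarrow> ('g \<rightharpoonup> 'y) set" where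
  "partial_funs Y \<X> = {a. dom a \<in> \<X> \<and> ran a \<subseteq> carrier Y}"

definition preimg :: "'y set \<Rightarrow> ('g \<rightharpoonup> 'y) \<Rightarrow> 'g set" where
  "preimg W a = {g \<in> dom a. the (a g) \<in> W}"

text \<open>The value of the product at \<open>k\<close> is uniquely determined whenever one of the two domains
  is a bisection, which is the only case in which the product is used.\<close>

definition pf_mult ::
    "('g, 'm) groupoid_scheme \<Rightarrow> ('y, 'n) monoid_scheme \<Rightarrow> ('g \<rightharpoonup> 'y) \<Rightarrow> ('g \<rightharpoonup> 'y) \<Rightarrow> ('g \<rightharpoonup> 'y)"
  where
  "pf_mult G Y a b = (\<lambda>k.
     if k \<in> set_gmult G (dom a) (dom b)
     then Some (THE y. \<exists>g\<in>dom a. \<exists>h\<in>dom b.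
            src G g = rng G h \<and> k = g \<cdot>\<^bsub>G\<^esub> h \<and> y = the (a g) \<otimes>\<^bsub>Y\<^esub> the (b h))
     else None)"

text \<open>Associativity is automatic for functions defined on bisections of a groupoid, so being a
  semigroup amounts to closure under the product.\<close>

definition pf_semigroup ::
    "('g, 'm) groupoid_scheme \<Rightarrow> ('y, 'n) monoid_scheme \<Rightarrow> ('g \<rightharpoonup> 'y) set \<Rightarrow> bool" where
  "pf_semigroup G Y S \<longleftrightarrow> (\<forall>a\<in>S. \<forall>b\<in>S. pf_mult G Y a b \<in> S)"

section \<open>Bumpy families\<close>

text \<open>An equation between values of partial functions, or their inverses in \<open>Y\<close>, asserts in
  particular that both sides are defined.\<close>

definition bumpy ::
    "('g, 'm) groupoid_scheme \<Rightarrow> 'g topology \<Rightarrow> ('y, 'n) monoid_scheme \<Rightarrow> ('g \<rightharpoonup> 'y) set \<Rightarrow> bool"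
  where
  "bumpy G T Y S \<longleftrightarrow>
     S \<subseteq> partial_funs Y (open_bisections G T) \<and>
     \<comment> \<open>1-Proper\<close>
     (\<forall>a\<in>S. compactin T (preimg {\<one>\<^bsub>Y\<^esub>} a)) \<and>
     \<comment> \<open>Urysohn\<close>
     Map.empty \<in> S \<and>
     (\<forall>U g. openin T U \<and> g \<in> U \<longrightarrow>
        (\<exists>a\<in>S. dom a \<subseteq> U \<and> g \<in> T interior_of (preimg (Units Y) a))) \<and>
     \<comment> \<open>Involutive\<close>
     (\<forall>a\<in>S. \<forall>g \<in> T interior_of (preimg (Units Y) a).
        (\<exists>b\<in>S. ginv G g \<in> T interior_of
           {h \<in> carrier G. ginv G h \<in> dom a \<and> h \<in> preimg (Units Y) b \<and>
              the (a (ginv G h)) = inv\<^bsub>Y\<^esub> (the (b h))}))"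

definition compact_bumpy ::
    "('g, 'm) groupoid_scheme \<Rightarrow> 'g topology \<Rightarrow> ('y, 'n) monoid_scheme \<Rightarrow> ('g \<rightharpoonup> 'y) set \<Rightarrow> bool"
  where
  "compact_bumpy G T Y S \<longleftrightarrow>
     bumpy G T Y S \<and>
     \<comment> \<open>Compact-Urysohn\<close>
     (\<forall>C \<in> compact_bisections G T. \<forall>U \<in> open_bisections G T. C \<subseteq> U \<longrightarrow>
        (\<exists>a\<in>S. dom a \<subseteq> U \<and> C \<subseteq> preimg (Units Y) a)) \<and>
     \<comment> \<open>Compact-Involutive\<close>
     (\<forall>a\<in>S. \<forall>C. compactin T C \<and> C \<subseteq> preimg (Units Y) a \<longrightarrow>
        (\<exists>b\<in>S. \<forall>g\<in>C. ginv G g \<in> dom b \<and> inv\<^bsub>Y\<^esub> (the (a g)) = the (b (ginv G g))))"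

section \<open>Domination\<close>

definition dominated_via ::
    "('g, 'm) groupoid_scheme \<Rightarrow> ('y, 'n) monoid_scheme \<Rightarrow> ('g \<rightharpoonup> 'y) set \<Rightarrow>
      ('g \<rightharpoonup> 'y) \<Rightarrow> ('g \<rightharpoonup> 'y) \<Rightarrow> ('g \<rightharpoonup> 'y) \<Rightarrow> bool" where
  "dominated_via G Y D s a b \<longleftrightarrow>
     pf_mult G Y (pf_mult G Y a s) b = a \<and> a = pf_mult G Y (pf_mult G Y b s) a \<and>
     pf_mult G Y a s \<in> D \<and> pf_mult G Y s a \<in> D"

definition dominated ::
    "('g, 'm) groupoid_scheme \<Rightarrow> ('y, 'n) monoid_scheme \<Rightarrow> ('g \<rightharpoonup> 'y) set \<Rightarrow> ('g \<rightharpoonup> 'y) set \<Rightarrow>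
      ('g \<rightharpoonup> 'y) \<Rightarrow> ('g \<rightharpoonup> 'y) \<Rightarrow> bool" where
  "dominated G Y S D a b \<longleftrightarrow> (\<exists>s\<in>S. dominated_via G Y D s a b)"

end

theory Submission
  imports Defs
begin

text \<open>
  Suppose \<open>dom a \<subseteq> C \<subseteq> [Y\<^sup>\<times>]b\<close> with \<open>C\<close> compact. The compact form of involutivity gives
  \<open>s \<in> S\<close> that inverts \<open>b\<close> on \<open>C\<close>. As \<open>dom s\<close> is a bisection containing the inverse of every
  \<open>g \<in> dom a\<close>, such a \<open>g\<close> composes with \<open>g\<inverse>\<close> and with nothing else in \<open>dom s\<close>. Hence \<open>as\<close> and
  \<open>sa\<close> live on units, and \<open>asb\<close> and \<open>bsa\<close> take the values \<open>a(g) b(g)\<inverse> b(g)\<close> and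
  \<open>b(g) b(g)\<inverse> a(g)\<close> at \<open>g\<close>.

  Suppose conversely that \<open>a\<close> is dominated by \<open>b\<close> via \<open>s\<close>. The compact set is read off from
  \<open>[1](bs)\<close>, which is compact by 1-properness. As \<open>dom b\<close> is a bisection, \<open>g\<close> is determined by
  the product \<open>gh\<close> of \<open>g \<in> dom b\<close> and \<open>h \<in> dom s\<close>, so there is a left factor map
  \<open>gh \<mapsto> g\<close> from \<open>dom(bs)\<close> to \<open>dom b\<close>. Let \<open>C\<close> be the image of \<open>[1](bs)\<close> under this map.
  \<^item> \<open>C\<close> is compact since the left factor map is continuous: the preimage of an open
    \<open>U\<close> is the product of \<open>U \<inter> dom b\<close> and \<open>dom s\<close>. Such products are open even though the
    topology is not assumed compatible with the groupoid structure: by Urysohn they are unions of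
    domains of products \<open>cs\<close> with \<open>c \<in> S\<close>, and those domains are open because \<open>S\<close> is a
    semigroup of functions with open domains.
  \<^item> \<open>C \<subseteq> [Y\<^sup>\<times>]b\<close> since \<open>xy = 1\<close> gives \<open>xyx = x\<close>, and so \<open>yx = 1\<close> by 1-cancellation.
  \<^item> \<open>dom a \<subseteq> C\<close> since \<open>asb = a\<close> and \<open>dom(as)\<close> consisting of units force
    \<open>a(g) s(h) b(g) = a(g)\<close> for some \<open>h \<in> dom s\<close> composable with \<open>g\<close>. Cancelling \<open>a(g)\<close> makes
    \<open>s(h)\<close> and \<open>b(g)\<close> inverse to each other, so that \<open>gh \<in> [1](bs)\<close>.
\<close>

section \<open>Groupoid arithmetic and bisections\<close>

context groupoid
begin

lemma src_ginv: "g \<in> carrier G \<Longrightarrow> src G (ginv G g) = rng G g"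
  by (simp add: src_def rng_def ginv_ginv)

lemma rng_ginv: "g \<in> carrier G \<Longrightarrow> rng G (ginv G g) = src G g"
  by (simp add: src_def rng_def ginv_ginv)

lemma src_gmult:
  assumes "g \<in> carrier G" "h \<in> carrier G" "src G g = rng G h"
  shows "src G (g \<cdot> h) = src G h"
  using composable_left[of g h "ginv G h"] assms by (simp add: rng_ginv ginv_closed)

lemma rng_gmult:
  assumes "g \<in> carrier G" "h \<in> carrier G" "src G g = rng G h"
  shows "rng G (g \<cdot> h) = rng G g"
  using composable_right[of "ginv G g" g h] assms by (simp add: src_ginv ginv_closed)

lemma gmult_src: "g \<in> carrier G \<Longrightarrow> g \<cdot> src G g = g"
  using ginv_cancel_left[of "ginv G g" g]
  by (simp add: src_ginv ginv_closed ginv_ginv flip: src_def)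

lemma rng_gmult_self: "g \<in> carrier G \<Longrightarrow> rng G g \<cdot> g = g"
  using ginv_cancel_right[of g "ginv G g"]
  by (simp add: rng_ginv ginv_closed ginv_ginv flip: rng_def)

lemma src_in_units: "g \<in> carrier G \<Longrightarrow> src G g \<in> units G"
  by (simp add: units_def)

lemma rng_in_units: "g \<in> carrier G \<Longrightarrow> rng G g \<in> units G"
  using src_in_units[OF ginv_closed] by (simp add: src_ginv)

lemma src_unit: "u \<in> units G \<Longrightarrow> src G u = u"
  unfolding units_def
  using src_gmult[OF ginv_closed _ src_ginv] by (auto simp flip: src_def)

lemma rng_unit: "u \<in> units G \<Longrightarrow> rng G u = u"
  unfolding units_def
  using rng_gmult[OF ginv_closed _ src_ginv] by (auto simp: rng_ginv simp flip: src_def)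

lemma bisection_subset: "bisection G B \<Longrightarrow> B \<subseteq> carrier G"
  by (simp add: bisection_def)

lemma inj_on_rng_bisection:
  assumes "bisection G B"
  shows "inj_on (rng G) B"
proof (rule inj_onI)
  fix x y assume B: "x \<in> B" "y \<in> B" and eq: "rng G x = rng G y"
  have c: "x \<in> carrier G" "y \<in> carrier G" "ginv G x \<in> carrier G"
    using assms B bisection_subset ginv_closed by auto
  let ?u = "ginv G x \<cdot> y"
  have sr: "src G (ginv G x) = rng G y" using c eq by (simp add: src_ginv)
  have "?u \<in> set_gmult G (ginv G ` B) B"
    using B sr unfolding set_gmult_def by blast
  then have "?u \<in> units G" using assms by (auto simp: bisection_def)
  then have "?u = src G x"
    using rng_unit rng_gmult[OF c(3,2) sr] rng_ginv[OF c(1)] by metis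
  moreover have "x \<cdot> ?u = y"
    using ginv_cancel_left[OF c(3,2) sr] c by (simp add: ginv_ginv)
  ultimately show "x = y" using gmult_src c by simp
qed

text \<open>The defining condition on a bisection is symmetric under inversion, which exchanges source
  and range.\<close>

lemma bisection_ginv:
  assumes "bisection G B"
  shows "bisection G (ginv G ` B)"
proof -
  have "ginv G ` ginv G ` B = B"
    using bisection_subset[OF assms] by (force simp: image_image ginv_ginv)
  then show ?thesis
    using assms ginv_closed by (auto simp: bisection_def)
qed

lemma inj_on_src_bisection:
  assumes "bisection G B"
  shows "inj_on (src G) B"
proof (rule inj_onI)
  fix x y assume B: "x \<in> B" "y \<in> B" and eq: "src G x = src G y"
  have c: "x \<in> carrier G" "y \<in> carrier G" using assms B bisection_subset by auto
  then have "ginv G x = ginv G y"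
    using inj_onD[OF inj_on_rng_bisection[OF bisection_ginv[OF assms]], of "ginv G x" "ginv G y"]
      B eq by (simp add: rng_ginv)
  then show "x = y" using c ginv_ginv by metis
qed

section \<open>Products of partial functions\<close>

lemma dom_pf_mult: "dom (pf_mult G Y a b) = set_gmult G (dom a) (dom b)"
  by (auto simp: pf_mult_def dom_def)

lemma set_gmultI:
  "\<lbrakk>g \<in> A; h \<in> B; src G g = rng G h\<rbrakk> \<Longrightarrow> g \<cdot> h \<in> set_gmult G A B"
  unfolding set_gmult_def by blast

lemma set_gmultE:
  assumes "k \<in> set_gmult G A B"
  obtains g h where "g \<in> A" "h \<in> B" "src G g = rng G h" "k = g \<cdot> h"
  using assms unfolding set_gmult_def by blast

text \<open>The range of a product is the range of its left factor, so a left factor in a bisection can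
  be recovered from the product, and the right factor by cancelling it.\<close>

lemma factorization_unique:
  assumes A: "bisection G A" and B: "B \<subseteq> carrier G"
    and "g \<in> A" "h \<in> B" "src G g = rng G h"
    and "g' \<in> A" "h' \<in> B" "src G g' = rng G h'"
    and eq: "g \<cdot> h = g' \<cdot> h'"
  shows "g = g'" "h = h'"
proof -
  have c: "g \<in> carrier G" "h \<in> carrier G" "g' \<in> carrier G" "h' \<in> carrier G"
    using assms bisection_subset by auto
  have "rng G g = rng G g'"
    using rng_gmult c assms(5,8) eq by metis
  then show g: "g = g'"
    using inj_on_rng_bisection[OF A] assms(3,6) by (auto dest: inj_onD)
  show "h = h'"
    using ginv_cancel_left c assms(5,8) eq g by metis
qed

lemma pf_mult_gmult:
  assumes A: "bisection G (dom a)" and B: "dom b \<subseteq> carrier G"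
    and gh: "g \<in> dom a" "h \<in> dom b" "src G g = rng G h"
  shows "pf_mult G Y a b (g \<cdot> h) = Some (the (a g) \<otimes>\<^bsub>Y\<^esub> the (b h))"
proof -
  have "(THE y. \<exists>g'\<in>dom a. \<exists>h'\<in>dom b.
           src G g' = rng G h' \<and> g \<cdot> h = g' \<cdot> h' \<and> y = the (a g') \<otimes>\<^bsub>Y\<^esub> the (b h'))
        = the (a g) \<otimes>\<^bsub>Y\<^esub> the (b h)"
    using gh factorization_unique[OF A B] by (intro the_equality) blast+
  then show ?thesis
    using set_gmultI[OF gh] by (simp add: pf_mult_def)
qed

end

section \<open>Consequences of 1-cancellation\<close>

lemma one_cancellative_right_eq_oneD:
  assumes "one_cancellative Y" "x \<in> carrier Y" "y \<in> carrier Y" "x \<otimes>\<^bsub>Y\<^esub> y = x"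
  shows "y = \<one>\<^bsub>Y\<^esub>"
  using assms unfolding one_cancellative_def by blast

text \<open>If \<open>xy = 1\<close>, then \<open>x(yx) = (xy)x = x\<close>, so \<open>yx\<close> cancels to \<open>1\<close>.\<close>

lemma one_cancellative_inverse_commute:
  assumes "monoid Y" "one_cancellative Y" "x \<in> carrier Y" "y \<in> carrier Y"
    and "x \<otimes>\<^bsub>Y\<^esub> y = \<one>\<^bsub>Y\<^esub>"
  shows "y \<otimes>\<^bsub>Y\<^esub> x = \<one>\<^bsub>Y\<^esub>"
proof -
  interpret monoid Y by fact
  have "x \<otimes>\<^bsub>Y\<^esub> (y \<otimes>\<^bsub>Y\<^esub> x) = x"
    using assms(3-5) by (simp flip: m_assoc)
  then show ?thesis
    using assms by (intro one_cancellative_right_eq_oneD[of Y x]) auto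
qed

section \<open>The left factor map of a product\<close>

lemma bumpy_memD:
  assumes "bumpy G T Y S" "a \<in> S"
  shows "bisection G (dom a)" "openin T (dom a)" "compactin T (preimg {\<one>\<^bsub>Y\<^esub>} a)"
    and "\<And>g. g \<in> dom a \<Longrightarrow> the (a g) \<in> carrier Y"
proof -
  have a: "a \<in> partial_funs Y (open_bisections G T)"
    using assms(2) by (rule subsetD[rotated]) (use assms(1) in \<open>simp add: bumpy_def\<close>)
  then show "bisection G (dom a)" "openin T (dom a)"
    by (auto simp: partial_funs_def open_bisections_def)
  show "compactin T (preimg {\<one>\<^bsub>Y\<^esub>} a)"
    using assms by (simp add: bumpy_def)
  show "the (a g) \<in> carrier Y" if "g \<in> dom a" for g
    using a that by (auto simp: partial_funs_def ran_def)
qed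

context groupoid
begin

text \<open>By Urysohn, the left factor \<open>g\<close> of an element of the product lies in the domain of some
  \<open>c \<in> S\<close> inside \<open>V\<close>. The domain of \<open>cs\<close> is then an open neighbourhood of that element within
  the product. This replaces the openness of multiplication in an etale topological groupoid.\<close>

lemma openin_set_gmult_dom:
  assumes bumpy: "bumpy G T Y S" and semi: "pf_semigroup G Y S"
    and s: "s \<in> S" and V: "openin T V"
  shows "openin T (set_gmult G V (dom s))"
proof (subst openin_subopen, intro ballI)
  fix k assume "k \<in> set_gmult G V (dom s)"
  then obtain g h where gh: "g \<in> V" "h \<in> dom s" "src G g = rng G h" "k = g \<cdot> h"
    by (rule set_gmultE)
  have "\<forall>U g. openin T U \<and> g \<in> U \<longrightarrow>
      (\<exists>c\<in>S. dom c \<subseteq> U \<and> g \<in> T interior_of (preimg (Units Y) c))"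
    using bumpy unfolding bumpy_def by (elim conjE)
  then obtain c where c: "c \<in> S" "dom c \<subseteq> V" "g \<in> T interior_of preimg (Units Y) c"
    using V gh(1) by meson
  have "g \<in> dom c"
    using c(3) interior_of_subset[of T "preimg (Units Y) c"] by (auto simp: preimg_def)
  then have "k \<in> dom (pf_mult G Y c s)"
    using gh set_gmultI by (simp add: dom_pf_mult)
  moreover have "openin T (dom (pf_mult G Y c s))"
    using semi c(1) s bumpy_memD(2)[OF bumpy] by (simp add: pf_semigroup_def)
  moreover have "dom (pf_mult G Y c s) \<subseteq> set_gmult G V (dom s)"
    using c(2) unfolding dom_pf_mult set_gmult_def by blast
  ultimately show "\<exists>U. openin T U \<and> k \<in> U \<and> U \<subseteq> set_gmult G V (dom s)" by blast
qed

text \<open>A product and its left factor have the same range, which is why this is the left factor when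
  \<open>k\<close> is a product with left factor in the bisection \<open>B\<close>.\<close>

definition left_factor :: "'a set \<Rightarrow> 'a \<Rightarrow> 'a" where
  "left_factor B k = inv_into B (rng G) (rng G k)"

lemma left_factor_gmult:
  assumes "bisection G B" "g \<in> B" "h \<in> carrier G" "src G g = rng G h"
  shows "left_factor B (g \<cdot> h) = g"
proof -
  have "rng G (g \<cdot> h) = rng G g"
    using rng_gmult assms bisection_subset by blast
  then show ?thesis
    using inv_into_f_f[OF inj_on_rng_bisection[OF assms(1)] assms(2)]
    by (simp add: left_factor_def)
qed

lemma continuous_map_left_factor:
  assumes bumpy: "bumpy G T Y S" and semi: "pf_semigroup G Y S"
    and b: "b \<in> S" and s: "s \<in> S"
  shows "continuous_map (subtopology T (dom (pf_mult G Y b s))) T (left_factor (dom b))"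
proof -
  let ?P = "dom (pf_mult G Y b s)" and ?f = "left_factor (dom b)"
  note [simp] = bumpy_memD[OF bumpy]
  have P: "openin T ?P" using semi b s by (simp add: pf_semigroup_def)
  then have top: "topspace (subtopology T ?P) = ?P"
    using openin_subset by (fastforce simp: topspace_subtopology)
  have f: "?f (g \<cdot> h) = g" if "g \<in> dom b" "h \<in> dom s" "src G g = rng G h" for g h
    using that left_factor_gmult b s bisection_subset bumpy_memD(1)[OF bumpy] by blast
  have "?f \<in> ?P \<rightarrow> topspace T"
  proof
    fix k assume "k \<in> ?P"
    then have "?f k \<in> dom b"
      unfolding dom_pf_mult by (elim set_gmultE) (simp add: f)
    then show "?f k \<in> topspace T"
      using openin_subset[of T "dom b"] b by auto
  qed
  moreover have "openin (subtopology T ?P) {k \<in> ?P. ?f k \<in> U}" if U: "openin T U" for U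
  proof -
    have "{k \<in> ?P. ?f k \<in> U} = set_gmult G (U \<inter> dom b) (dom s)"
      unfolding dom_pf_mult set_gmult_def using f by fastforce
    moreover have "openin T (set_gmult G (U \<inter> dom b) (dom s))"
      using U b by (intro openin_set_gmult_dom[OF bumpy semi s] openin_Int) auto
    ultimately show ?thesis
      using openin_open_subtopology[OF P] by auto
  qed
  ultimately show ?thesis by (simp only: continuous_map_def top) blast
qed

section \<open>Domination and compact containment\<close>

lemma dominated_via_imp_compactly_inside:
  assumes Y: "monoid Y" "one_cancellative Y"
    and bumpy: "bumpy G T Y S" and semi: "pf_semigroup G Y S"
    and S: "a \<in> S" "b \<in> S" "s \<in> S"
    and asb: "pf_mult G Y (pf_mult G Y a s) b = a"
    and as_units: "dom (pf_mult G Y a s) \<subseteq> units G"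
  shows "compactly_inside T (dom a) (preimg (Units Y) b)"
proof -
  interpret Y: monoid Y by fact
  note bis = bumpy_memD(1)[OF bumpy] and val = bumpy_memD(4)[OF bumpy]
  have car: "dom c \<subseteq> carrier G" if "c \<in> S" for c
    using bisection_subset bis that by blast
  have prod: "pf_mult G Y a s \<in> S" "pf_mult G Y b s \<in> S"
    using semi S by (auto simp: pf_semigroup_def)
  let ?K = "preimg {\<one>\<^bsub>Y\<^esub>} (pf_mult G Y b s)"
  let ?C = "left_factor (dom b) ` ?K"
  have bs_val: "the (pf_mult G Y b s (g \<cdot> h)) = the (b g) \<otimes>\<^bsub>Y\<^esub> the (s h)"
    if "g \<in> dom b" "h \<in> dom s" "src G g = rng G h" for g h
    using pf_mult_gmult[where Y = Y, OF bis[OF S(2)] car[OF S(3)] that] by simp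
  have "compactin (subtopology T (dom (pf_mult G Y b s))) ?K"
    using bumpy_memD(3)[OF bumpy prod(2)] by (auto simp: compactin_subtopology preimg_def)
  then have "compactin T ?C"
    using image_compactin continuous_map_left_factor[OF bumpy semi S(2,3)] by blast
  moreover have "?C \<subseteq> preimg (Units Y) b"
  proof
    fix g assume "g \<in> ?C"
    then obtain k where k: "k \<in> ?K" "g = left_factor (dom b) k" by blast
    then have "k \<in> set_gmult G (dom b) (dom s)" by (simp add: preimg_def dom_pf_mult)
    then obtain g' h where gh: "g' \<in> dom b" "h \<in> dom s" "src G g' = rng G h" "k = g' \<cdot> h"
      by (rule set_gmultE)
    have "g = g'" using k(2) gh left_factor_gmult[OF bis[OF S(2)]] car[OF S(3)] by auto
    then have g: "g \<in> dom b" and "the (b g) \<otimes>\<^bsub>Y\<^esub> the (s h) = \<one>\<^bsub>Y\<^esub>"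
      using k(1) gh bs_val[OF gh(1-3)] by (auto simp: preimg_def)
    moreover have "the (b g) \<in> carrier Y" "the (s h) \<in> carrier Y"
      using val S g gh by auto
    ultimately show "g \<in> preimg (Units Y) b"
      using one_cancellative_inverse_commute[OF Y] unfolding preimg_def Units_def by blast
  qed
  moreover have "dom a \<subseteq> ?C"
  proof
    fix g assume g: "g \<in> dom a"
    then have "g \<in> set_gmult G (dom (pf_mult G Y a s)) (dom b)"
      using asb dom_pf_mult by metis
    then obtain m k where mk: "m \<in> dom (pf_mult G Y a s)" "k \<in> dom b"
        "src G m = rng G k" "g = m \<cdot> k" by (rule set_gmultE)
    then have "m \<in> set_gmult G (dom a) (dom s)" by (simp add: dom_pf_mult)
    then obtain x h where xh: "x \<in> dom a" "h \<in> dom s" "src G x = rng G h" "m = x \<cdot> h"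
      by (rule set_gmultE)
    have c: "g \<in> carrier G" "k \<in> carrier G" "x \<in> carrier G" "h \<in> carrier G"
      using g mk xh S car by auto
    have u: "m \<in> units G" using mk(1) as_units by blast
    \<comment> \<open>The unit \<open>m\<close> is the range of \<open>k\<close>, so multiplying by it changes nothing.\<close>
    then have m: "m = rng G k" using mk(3) src_unit by simp
    then have gk: "g = k" using mk(4) c rng_gmult_self by simp
    have "rng G x = rng G g"
      using rng_gmult[OF c(3,4) xh(3)] xh(4) rng_unit[OF u] m gk by simp
    then have xg: "x = g"
      using inj_on_rng_bisection[OF bis[OF S(1)]] xh(1) g by (auto dest: inj_onD)
    have gb: "g \<in> dom b" using mk(2) gk by simp
    have Yc: "the (a g) \<in> carrier Y" "the (s h) \<in> carrier Y" "the (b g) \<in> carrier Y"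
      using val S g xh gb by auto
    have "pf_mult G Y a s m = Some (the (a g) \<otimes>\<^bsub>Y\<^esub> the (s h))"
      using pf_mult_gmult[where Y = Y, OF bis[OF S(1)] car[OF S(3)] xh(1-3)] xh(4) xg by simp
    moreover have "pf_mult G Y (pf_mult G Y a s) b (m \<cdot> k)
        = Some (the (pf_mult G Y a s m) \<otimes>\<^bsub>Y\<^esub> the (b k))"
      using pf_mult_gmult[where Y = Y, OF bis[OF prod(1)] car[OF S(2)] mk(1-3)] .
    ultimately have "a g = Some (the (a g) \<otimes>\<^bsub>Y\<^esub> the (s h) \<otimes>\<^bsub>Y\<^esub> the (b g))"
      using asb mk(4) gk by simp
    then have "the (a g) \<otimes>\<^bsub>Y\<^esub> (the (s h) \<otimes>\<^bsub>Y\<^esub> the (b g)) = the (a g)"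
      using Yc by (metis option.sel Y.m_assoc)
    then have "the (s h) \<otimes>\<^bsub>Y\<^esub> the (b g) = \<one>\<^bsub>Y\<^esub>"
      using Yc by (intro one_cancellative_right_eq_oneD[OF Y(2) Yc(1)]) auto
    then have "the (b g) \<otimes>\<^bsub>Y\<^esub> the (s h) = \<one>\<^bsub>Y\<^esub>"
      using one_cancellative_inverse_commute[OF Y] Yc by blast
    then have "g \<cdot> h \<in> ?K"
      using bs_val[of g h] gb xh xg set_gmultI[of g "dom b" h "dom s"]
      unfolding preimg_def dom_pf_mult by simp
    moreover have "left_factor (dom b) (g \<cdot> h) = g"
      using left_factor_gmult[OF bis[OF S(2)] gb c(4)] xh(3) xg by simp
    ultimately show "g \<in> ?C" by force
  qed
  ultimately show ?thesis unfolding compactly_inside_def by blast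
qed

text \<open>An element composable with \<open>g \<in> dom a\<close> shares its range or its source with \<open>g\<inverse>\<close>. Since
  \<open>g\<inverse>\<close> lies in the bisection \<open>dom s\<close>, no other element of \<open>dom s\<close> does so.\<close>

lemma pf_mult_pointwise_inverse:
  assumes Y: "monoid Y"
    and bis: "bisection G (dom a)" "bisection G (dom b)" "bisection G (dom s)"
    and val: "\<And>g. g \<in> dom a \<Longrightarrow> the (a g) \<in> carrier Y"
    and inv: "\<And>g. g \<in> dom a \<Longrightarrow> g \<in> dom b \<and> the (b g) \<in> Units Y \<and>
        ginv G g \<in> dom s \<and> the (s (ginv G g)) = inv\<^bsub>Y\<^esub> the (b g)"
    and prod: "bisection G (dom (pf_mult G Y a s))" "bisection G (dom (pf_mult G Y b s))"
  shows "dom (pf_mult G Y a s) \<subseteq> units G" "dom (pf_mult G Y s a) \<subseteq> units G"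
    and "pf_mult G Y (pf_mult G Y a s) b = a" "pf_mult G Y (pf_mult G Y b s) a = a"
proof -
  interpret Y: monoid Y by fact
  note car = bis[THEN bisection_subset]
  have right: "h = ginv G g" if "g \<in> dom a" "h \<in> dom s" "src G g = rng G h" for g h
  proof -
    have "rng G h = rng G (ginv G g)" using that rng_ginv[of g] car(1) by auto
    then show ?thesis
      using inj_on_rng_bisection[OF bis(3)] that inv[of g] by (auto dest: inj_onD)
  qed
  have left: "h = ginv G g" if "g \<in> dom a" "h \<in> dom s" "src G h = rng G g" for g h
  proof -
    have "src G h = src G (ginv G g)" using that src_ginv[of g] car(1) by auto
    then show ?thesis
      using inj_on_src_bisection[OF bis(3)] that inv[of g] by (auto dest: inj_onD)
  qed
  have as_cases: "\<exists>g\<in>dom a. m = rng G g" if "m \<in> dom (pf_mult G Y a s)" for m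
    using that right unfolding dom_pf_mult by (elim set_gmultE) (auto simp: rng_def)
  have sa_cases: "\<exists>g\<in>dom a. m = src G g" if "m \<in> dom (pf_mult G Y s a)" for m
    using that left unfolding dom_pf_mult by (elim set_gmultE) (auto simp: src_def)
  show as_units: "dom (pf_mult G Y a s) \<subseteq> units G"
    using as_cases rng_in_units car(1) by blast
  show "dom (pf_mult G Y s a) \<subseteq> units G"
    using sa_cases src_in_units car(1) by blast

  have as_b: "pf_mult G Y (pf_mult G Y a s) b g = a g" if g: "g \<in> dom a" for g
  proof -
    have c: "g \<in> carrier G" using g car(1) by blast
    have sr: "src G g = rng G (ginv G g)" using c by (simp add: rng_ginv)
    have v: "pf_mult G Y a s (rng G g)
        = Some (the (a g) \<otimes>\<^bsub>Y\<^esub> inv\<^bsub>Y\<^esub> the (b g))"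
      using pf_mult_gmult[where Y = Y, OF bis(1) car(3) g, of "ginv G g"]
        sr inv[OF g] by (simp add: rng_def)
    have "pf_mult G Y (pf_mult G Y a s) b (rng G g \<cdot> g)
        = Some (the (pf_mult G Y a s (rng G g)) \<otimes>\<^bsub>Y\<^esub> the (b g))"
      using v inv[OF g] src_unit[OF rng_in_units[OF c]]
      by (intro pf_mult_gmult prod car) auto
    then show ?thesis
      using v g inv[OF g] val[OF g] c
      by (auto simp: rng_gmult_self Y.m_assoc Y.Units_closed)
  qed
  moreover have "dom (pf_mult G Y (pf_mult G Y a s) b) \<subseteq> dom a"
  proof
    fix k assume "k \<in> dom (pf_mult G Y (pf_mult G Y a s) b)"
    then obtain m h where mh: "m \<in> dom (pf_mult G Y a s)" "h \<in> dom b" "src G m = rng G h"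
        "k = m \<cdot> h"
      unfolding dom_pf_mult[of Y "pf_mult G Y a s"] by (elim set_gmultE)
    then obtain g where g: "g \<in> dom a" "m = rng G g" using as_cases by blast
    have "m = rng G h" using mh(1,3) as_units src_unit by auto
    then have "h = g"
      using inj_on_rng_bisection[OF bis(2)] g mh(2) inv[OF g(1)] by (auto dest: inj_onD)
    then show "k \<in> dom a" using mh(4) g rng_gmult_self car(1) by auto
  qed
  ultimately show "pf_mult G Y (pf_mult G Y a s) b = a"
    by (intro ext) (metis domIff subsetD)

  have bs_a: "pf_mult G Y (pf_mult G Y b s) a g = a g" if g: "g \<in> dom a" for g
  proof -
    have c: "g \<in> carrier G" using g car(1) by blast
    have sr: "src G g = rng G (ginv G g)" using c by (simp add: rng_ginv)
    have v: "pf_mult G Y b s (rng G g) = Some (the (b g) \<otimes>\<^bsub>Y\<^esub> inv\<^bsub>Y\<^esub> the (b g))"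
      using pf_mult_gmult[where Y = Y, OF bis(2) car(3), of g "ginv G g"]
        sr inv[OF g] by (simp add: rng_def)
    have "pf_mult G Y (pf_mult G Y b s) a (rng G g \<cdot> g)
        = Some (the (pf_mult G Y b s (rng G g)) \<otimes>\<^bsub>Y\<^esub> the (a g))"
      using v g src_unit[OF rng_in_units[OF c]]
      by (intro pf_mult_gmult prod car) auto
    then show ?thesis
      using v g inv[OF g] val[OF g] c by (auto simp: rng_gmult_self)
  qed
  moreover have "dom (pf_mult G Y (pf_mult G Y b s) a) \<subseteq> dom a"
  proof
    fix k assume "k \<in> dom (pf_mult G Y (pf_mult G Y b s) a)"
    then obtain m g where mg: "m \<in> dom (pf_mult G Y b s)" "g \<in> dom a" "src G m = rng G g"
        "k = m \<cdot> g"
      unfolding dom_pf_mult[of Y "pf_mult G Y b s"] by (elim set_gmultE)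
    from mg(1) obtain x h where xh: "x \<in> dom b" "h \<in> dom s" "src G x = rng G h" "m = x \<cdot> h"
      unfolding dom_pf_mult by (elim set_gmultE)
    have c: "x \<in> carrier G" "h \<in> carrier G" "g \<in> carrier G" using xh mg car by auto
    \<comment> \<open>The product \<open>bs\<close> may also be defined off the units; composability with \<open>g\<close> picks out the
      factor \<open>h\<close>, and \<open>h\<close> in turn picks out \<open>x\<close>.\<close>
    have "h = ginv G g"
      using left[OF mg(2) xh(2)] src_gmult[OF c(1,2) xh(3)] mg(3) xh(4) by simp
    moreover from this have "x = g"
      using inj_on_src_bisection[OF bis(2)] xh inv[OF mg(2)] rng_ginv[OF c(3)]
      by (auto dest: inj_onD)
    ultimately have "k = g" using mg(4) xh(4) rng_gmult_self[OF c(3)] by (simp add: rng_def)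
    then show "k \<in> dom a" using mg(2) by simp
  qed
  ultimately show "pf_mult G Y (pf_mult G Y b s) a = a"
    by (intro ext) (metis domIff subsetD)
qed

lemma compactly_inside_imp_dominated:
  assumes Y: "monoid Y"
    and cb: "compact_bumpy G T Y S" and semi: "pf_semigroup G Y S"
    and S: "a \<in> S" "b \<in> S"
    and ci: "compactly_inside T (dom a) (preimg (Units Y) b)"
  shows "dominated G Y S {d \<in> S. dom d \<subseteq> units G} a b"
proof -
  have bumpy: "bumpy G T Y S" using cb by (simp add: compact_bumpy_def)
  obtain C where C: "compactin T C" "dom a \<subseteq> C" "C \<subseteq> preimg (Units Y) b"
    using ci by (auto simp: compactly_inside_def)
  have "\<forall>a\<in>S. \<forall>C. compactin T C \<and> C \<subseteq> preimg (Units Y) a \<longrightarrow>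
      (\<exists>b\<in>S. \<forall>g\<in>C. ginv G g \<in> dom b \<and> inv\<^bsub>Y\<^esub> (the (a g)) = the (b (ginv G g)))"
    using cb unfolding compact_bumpy_def by (elim conjE)
  then have "\<exists>s\<in>S. \<forall>g\<in>C. ginv G g \<in> dom s \<and> inv\<^bsub>Y\<^esub> (the (b g)) = the (s (ginv G g))"
    using C S(2) by simp
  then obtain s where s: "s \<in> S"
      "\<forall>g\<in>C. ginv G g \<in> dom s \<and> inv\<^bsub>Y\<^esub> the (b g) = the (s (ginv G g))" ..
  have mult: "pf_mult G Y c d \<in> S" if "c \<in> S" "d \<in> S" for c d
    using semi that by (simp add: pf_semigroup_def)
  have inv: "g \<in> dom b \<and> the (b g) \<in> Units Y \<and>
      ginv G g \<in> dom s \<and> the (s (ginv G g)) = inv\<^bsub>Y\<^esub> the (b g)" if "g \<in> dom a" for g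
  proof -
    have "g \<in> C" using that C(2) by blast
    then show ?thesis using C(3) s(2) by (auto simp: preimg_def)
  qed
  note bis = bumpy_memD(1)[OF bumpy]
  note * = pf_mult_pointwise_inverse[OF Y bis[OF S(1)] bis[OF S(2)] bis[OF s(1)]
      bumpy_memD(4)[OF bumpy S(1)] inv bis[OF mult[OF S(1) s(1)]] bis[OF mult[OF S(2) s(1)]]]
  show ?thesis
    unfolding dominated_def dominated_via_def
    using s(1) * mult S by (intro bexI[of _ s]) auto
qed

end

theorem proposition4p4:
  fixes G :: "('g, 'm) groupoid_scheme" and T :: "'g topology"
    and Y :: "('y, 'n) monoid_scheme" and S D :: "('g \<rightharpoonup> 'y) set"
  assumes "groupoid G" and "topspace T = carrier G"
    and "Hausdorff_space (subtopology T (units G))"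
    and "monoid Y" and "one_cancellative Y"
    and "compact_bumpy G T Y S" and "pf_semigroup G Y S"
    and "D = {d \<in> S. dom d \<subseteq> units G}"
    and "a \<in> S" and "b \<in> S"
  shows "dominated G Y S D a b \<longleftrightarrow> compactly_inside T (dom a) (preimg (Units Y) b)"
proof
  interpret groupoid G by fact
  have bumpy: "bumpy G T Y S" using assms(6) by (simp add: compact_bumpy_def)
  assume "dominated G Y S D a b"
  then obtain s where "s \<in> S" "dominated_via G Y D s a b"
    by (auto simp: dominated_def)
  then show "compactly_inside T (dom a) (preimg (Units Y) b)"
    using assms(8)
    by (intro dominated_via_imp_compactly_inside[OF assms(4,5) bumpy assms(7,9,10)])
      (auto simp: dominated_via_def)
next
  interpret groupoid G by fact
  assume "compactly_inside T (dom a) (preimg (Units Y) b)"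
  then show "dominated G Y S D a b"
    unfolding assms(8)
    by (rule compactly_inside_imp_dominated[OF assms(4,6,7,9,10)])
qed

end
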